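(* Let $T$ and $d$ be integers with $1\le d\le T$, and let $X=\{x\in\mathbb{R}^d:\|x\|_2\le 1\}$ be the Euclidean unit ball. There exist a convex $1$-Lipschitz function $f:X\to\mathbb{R}$ and a (deterministic) sub-gradient oracle for $f$ such that the iterates of projected sub-gradient descent on $f$ with this oracle, initial point $x_1=0$ and step sizes $\eta_t=1/\sqrt{t}$, i.e. $x_{t+1}=\Pi_X(x_t-\eta_t\hat g_t)$ with $\hat g_t\in\partial f(x_t)$ the vector returned by the oracle at step $t$ ($t=1,\dots,T$), satisfy $$f(x_{T+1})-\min_{x\in X}f(x)\ \ge\ \frac{\log d}{32\sqrt{T}}.$$
   Context: $\Pi_X$ denotes Euclidean projection onto $X$. For a convex function $f:X\to\mathbb{R}$ and $x\in X$, $\partial f(x)$ is the set of $g\in\mathbb{R}^d$ with $f(x')-f(x)\ge g^\top(x'-x)$ for all $x'\in X$. $f$ is $L$-Lipschitz if $|f(x)-f(y)|\le L\|x-y\|_2$ for all $x,y\in X$. A deterministic sub-gradient oracle returns, at each step $t$, some element of $\partial f(x_t)$ at the current iterate $x_t$; the choice may depend on the step index $t$ as well as on $x_t$. $\log$ is the natural logarithm. *)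

theory Defs
  imports "HOL-Analysis.Analysis"
begin

text \<open>The subgradient inequality is required only against points of the domain \<open>X\<close>, so at
  boundary points of \<open>X\<close> the subdifferential contains translates by the normal cone.
  Values of \<open>f\<close> outside \<open>X\<close> are irrelevant.\<close>

definition subdifferential :: "'a::real_inner set \<Rightarrow> ('a \<Rightarrow> real) \<Rightarrow> 'a \<Rightarrow> 'a set" where
  "subdifferential X f x = {g. \<forall>x'\<in>X. f x' - f x \<ge> g \<bullet> (x' - x)}"

text \<open>\<open>G t x\<close> is the answer at step \<open>t\<close> to the query \<open>x\<close>; being a function of \<open>t\<close> and \<open>x\<close>,
  the oracle is deterministic but may treat the same point differently at different steps.\<close>

definition subgradient_oracle ::
  "'a::real_inner set \<Rightarrow> ('a \<Rightarrow> real) \<Rightarrow> (nat \<Rightarrow> 'a \<Rightarrow> 'a) \<Rightarrow> bool" where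
  "subgradient_oracle X f G \<longleftrightarrow> (\<forall>t\<ge>1. \<forall>x\<in>X. G t x \<in> subdifferential X f x)"

text \<open>Iterates are numbered from 1: \<open>psgd X G \<eta> a 1 = a\<close>; the value at index 0 is a dummy.
  On a nonempty closed convex \<open>X\<close>, \<open>closest_point X\<close> is the Euclidean projection onto \<open>X\<close>.\<close>

primrec psgd ::
  "'a::euclidean_space set \<Rightarrow> (nat \<Rightarrow> 'a \<Rightarrow> 'a) \<Rightarrow> (nat \<Rightarrow> real) \<Rightarrow> 'a \<Rightarrow> nat \<Rightarrow> 'a" where
  "psgd X G \<eta> a 0 = a"
| "psgd X G \<eta> a (Suc t) =
     (if t = 0 then a
      else closest_point X (psgd X G \<eta> a t - \<eta> t *\<^sub>R G t (psgd X G \<eta> a t)))"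

end

theory Submission
  imports Defs
begin

text \<open>Let \<open>d\<close> be the dimension and \<open>s = T - d\<close>. Take \<open>f\<close> to be the maximum of \<open>0\<close> and of the linear
  forms \<open>h\<^sub>i = (a\<^sub>0, \<dots>, a\<^bsub>i-1\<^esub>, -b\<^sub>i, 0, \<dots>, 0)\<close>, \<open>i \<le> d\<close>, with \<open>a\<^sub>j = 1 / (8 (d - j))\<close>. All forms are
  active at \<open>0\<close>, so the oracle may answer \<open>0\<close> during the first \<open>s\<close> steps and then
  \<open>h\<^sub>0, h\<^sub>1, \<dots>, h\<^bsub>d-1\<^esub>\<close>. The answer \<open>h\<^sub>i\<close> raises the fresh coordinate \<open>i\<close> to \<open>1 / (2 \<surd>T)\<close> and lowers
  the earlier ones, each of which loses at most \<open>1 / (4 \<surd>T)\<close> in total. So the iterates stay inside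
  the ball, every iterate is nonnegative and supported on the coordinates already visited (which
  makes the next \<open>h\<^sub>i\<close> active), and at the end \<open>h\<^sub>d\<close> gives a value of at least
  \<open>(\<Sum>j. a\<^sub>j) / (4 \<surd>T)\<close>, a harmonic sum divided by \<open>32 \<surd>T\<close>.\<close>

section \<open>Maxima of finitely many linear forms\<close>

definition max_form :: "'a::real_inner set \<Rightarrow> 'a \<Rightarrow> real" where
  "max_form H x = Max ((\<lambda>h. h \<bullet> x) ` H)"

lemma max_form_ge: "finite H \<Longrightarrow> h \<in> H \<Longrightarrow> h \<bullet> x \<le> max_form H x"
  by (simp add: max_form_def)

lemma max_form_attained:
  assumes "finite H" "H \<noteq> {}"
  obtains h where "h \<in> H" "max_form H x = h \<bullet> x"
proof -
  have "max_form H x \<in> (\<lambda>h. h \<bullet> x) ` H"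
    unfolding max_form_def using assms by (intro Max_in) auto
  then show ?thesis using that by blast
qed

text \<open>\<open>g\<close> lies below the maximum everywhere and meets it at
  \<open>x\<close>.\<close>

lemma active_form_in_subdifferential:
  assumes "finite H" "g \<in> H" "\<And>h. h \<in> H \<Longrightarrow> h \<bullet> x \<le> g \<bullet> x"
  shows "g \<in> subdifferential X (max_form H) x"
proof -
  have "max_form H x = g \<bullet> x"
    unfolding max_form_def using assms by (intro Max_eqI) auto
  then show ?thesis
    using max_form_ge[OF assms(1,2)] by (simp add: subdifferential_def inner_diff_right)
qed

lemma subdifferential_max_form_nonempty:
  assumes "finite H" "H \<noteq> {}"
  shows "subdifferential X (max_form H) x \<noteq> {}"
proof -
  obtain g where "g \<in> H" "max_form H x = g \<bullet> x"
    using max_form_attained[OF assms] .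
  then show ?thesis
    using active_form_in_subdifferential[OF assms(1), of g x X] max_form_ge[OF assms(1), of _ x]
    by auto
qed

lemma convex_on_max_form:
  assumes "finite H" "H \<noteq> {}" "convex X"
  shows "convex_on X (max_form H)"
proof (rule convex_onI[OF _ assms(3)])
  fix t :: real and x y :: 'a
  assume t: "0 < t" "t < 1"
  obtain g where g: "g \<in> H" "max_form H ((1 - t) *\<^sub>R x + t *\<^sub>R y) = g \<bullet> ((1 - t) *\<^sub>R x + t *\<^sub>R y)"
    using max_form_attained[OF assms(1,2)] .
  have "(1 - t) * (g \<bullet> x) + t * (g \<bullet> y) \<le> (1 - t) * max_form H x + t * max_form H y"
    using t max_form_ge[OF assms(1) g(1)] by (intro add_mono mult_left_mono) auto
  then show "max_form H ((1 - t) *\<^sub>R x + t *\<^sub>R y) \<le> (1 - t) * max_form H x + t * max_form H y"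
    by (simp add: g(2) inner_add_right)
qed

lemma lipschitz_on_max_form:
  assumes "finite H" "H \<noteq> {}" "\<And>h. h \<in> H \<Longrightarrow> norm h \<le> L"
  shows "L-lipschitz_on X (max_form H)"
proof (rule lipschitz_onI)
  have diff: "max_form H x - max_form H y \<le> L * norm (x - y)" for x y
  proof -
    obtain g where g: "g \<in> H" "max_form H x = g \<bullet> x"
      using max_form_attained[OF assms(1,2)] .
    have "max_form H x - max_form H y \<le> g \<bullet> (x - y)"
      using max_form_ge[OF assms(1) g(1), of y] by (simp add: g(2) inner_diff_right)
    also have "\<dots> \<le> norm g * norm (x - y)" by (rule norm_cauchy_schwarz)
    also have "\<dots> \<le> L * norm (x - y)" using assms(3)[OF g(1)] by (intro mult_right_mono) auto
    finally show ?thesis .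
  qed
  show "dist (max_form H x) (max_form H y) \<le> L * dist x y" for x y
    using diff[of x y] diff[of y x] by (simp add: dist_norm norm_minus_commute abs_le_iff)
  show "0 \<le> L"
    using assms(2,3) norm_ge_zero order_trans by blast
qed

section \<open>Sum estimates\<close>

lemma sum_inverse_sqrt_le:
  assumes "p \<le> q"
  shows "(\<Sum>m = Suc p..q. 1 / sqrt (real m)) \<le> 2 * (sqrt (real q) - sqrt (real p))"
  using assms
proof (induction q rule: dec_induct)
  case (step n)
  let ?u = "sqrt (real (Suc n))" and ?v = "sqrt (real n)"
  \<comment> \<open>Conjugate roots: the second factor is at most \<open>2 * ?u\<close>, so each
    summand is bounded by a telescoping difference.\<close>
  have "(?u - ?v) * (?u + ?v) = 1"
    by (simp add: algebra_simps)
  moreover have "?u > 0" "?v \<le> ?u" by simp_all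
  ultimately have "1 \<le> (?u - ?v) * (2 * ?u)"
    by (metis add_left_mono diff_ge_0_iff_ge mult_2 mult_left_mono)
  then have "1 / ?u \<le> 2 * (?u - ?v)"
    using \<open>?u > 0\<close> by (simp add: field_simps)
  then show ?case using step by simp
qed simp

lemma sqrt_diff_le:
  fixes p q :: real
  assumes "0 \<le> p" "p \<le> q" "0 < q"
  shows "sqrt q - sqrt p \<le> (q - p) / sqrt q"
proof -
  have "sqrt p * sqrt p \<le> sqrt p * sqrt q"
    using assms by (intro mult_left_mono) auto
  then show ?thesis
    using assms by (simp add: field_simps)
qed

lemma sum_inverse_squares_le: "(\<Sum>k = 1..n. 1 / (real k)\<^sup>2) \<le> 2"
proof -
  \<comment> \<open>The sharper bound carries the induction, since \<open>1 / (n * Suc n)\<close>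
    telescopes.\<close>
  have "(\<Sum>k = 1..n. 1 / (real k)\<^sup>2) \<le> 2 - 1 / real n" if "n > 0"
    using that
  proof (induction n rule: nat_induct_non_zero)
    case (Suc n)
    have "1 / (real (Suc n))\<^sup>2 \<le> 1 / (real n * real (Suc n))"
      using Suc.hyps by (intro divide_left_mono) (auto simp: power2_eq_square intro: mult_right_mono)
    also have "\<dots> = 1 / real n - 1 / real (Suc n)"
      using Suc.hyps by (simp add: field_simps)
    finally show ?case using Suc.IH by simp
  qed simp
  then show ?thesis
    by (cases "n = 0") (auto intro: order_trans)
qed

section \<open>The hard instance\<close>

locale hard_instance =
  fixes idx :: "'n::finite \<Rightarrow> nat" and d T :: nat
  assumes bij: "bij_betw idx UNIV {..<d}"
    and d_le: "d \<le> T"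
begin

definition s :: nat where "s = T - d"

text \<open>Inversely proportional to the number of steps left: the loss of coordinate
  \<open>j\<close> is then bounded independently of \<open>j\<close>, while the weights still sum to
  a harmonic number.\<close>

definition a :: "nat \<Rightarrow> real" where "a j = 1 / (8 * real (d - j))"

text \<open>Cancels the step size \<open>1 / sqrt (s + i + 1)\<close>, so every fresh coordinate
  rises to the same height.\<close>

definition b :: "nat \<Rightarrow> real" where "b i = sqrt (real (s + i + 1)) / (2 * sqrt (real T))"

text \<open>For \<open>i = d\<close> there is no fresh coordinate: all entries are weights
  \<open>a j\<close>.\<close>

definition h :: "nat \<Rightarrow> real ^ 'n" where
  "h i = (\<chi> k. if idx k < i then a (idx k) else if idx k = i then - b i else 0)"

text \<open>The zero form allows the idle answers at the origin and makes the origin a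
  minimizer.\<close>

definition H :: "(real ^ 'n) set" where "H = insert 0 (h ` {..d})"

abbreviation f :: "real ^ 'n \<Rightarrow> real" where "f \<equiv> max_form H"

text \<open>Steps are numbered from 1, linear forms from 0. The fallback in \<open>G\<close> is never reached along the
  first \<open>T\<close> steps of the descent; it is there because an oracle must answer all queries at all steps.\<close>

definition answer :: "nat \<Rightarrow> real ^ 'n" where
  "answer t = (if t \<le> s then 0 else h (t - s - 1))"

definition G :: "nat \<Rightarrow> real ^ 'n \<Rightarrow> real ^ 'n" where
  "G t x = (if answer t \<in> subdifferential (cball 0 1) f x then answer t
            else SOME g. g \<in> subdifferential (cball 0 1) f x)"

text \<open>Closed form of the iterate with number \<open>s + i + 1\<close>.\<close>

definition y :: "nat \<Rightarrow> real ^ 'n" where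
  "y i = (\<chi> k. if idx k < i
     then 1 / (2 * sqrt (real T)) - a (idx k) * (\<Sum>m = s + idx k + 2..s + i. 1 / sqrt (real m))
     else 0)"

abbreviation iter :: "nat \<Rightarrow> real ^ 'n" where
  "iter \<equiv> psgd (cball 0 1) G (\<lambda>t. 1 / sqrt (real t)) 0"

section \<open>Coefficients and norms of the linear forms\<close>

lemma idx_less: "idx k < d"
  using bij by (auto dest: bij_betwE)

lemma sum_idx: "(\<Sum>k\<in>UNIV. g (idx k)) = (\<Sum>j<d. g j)"
  by (rule sum.reindex_bij_betw[OF bij])

lemma card_eq: "CARD('n) = d"
  using bij_betw_same_card[OF bij] by simp

lemma s_plus_d: "s + d = T"
  using d_le by (simp add: s_def)

lemma d_pos: "d > 0"
  using idx_less[of undefined] by linarith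

lemma T_pos: "T > 0"
  using d_le d_pos by linarith

lemma a_nonneg: "a j \<ge> 0"
  by (simp add: a_def)

lemma b_nonneg: "b i \<ge> 0"
  by (simp add: b_def)

lemma finite_H: "finite H" and H_nonempty: "H \<noteq> {}"
  by (simp_all add: H_def)

lemma b_le_half: "i < d \<Longrightarrow> b i \<le> 1 / 2"
  using s_plus_d T_pos by (simp add: b_def field_simps flip: of_nat_add)

lemma sum_a_eq: "(\<Sum>j<d. a j) = harm d / 8"
proof -
  have "(\<Sum>j<d. a j) = (\<Sum>j<d. inverse (real (d - j)) / 8)"
    by (simp add: a_def field_simps)
  also have "\<dots> = (\<Sum>j = 1..d. inverse (real j) / 8)"
    by (rule sum.reindex_bij_witness[of _ "\<lambda>j. d - j" "\<lambda>j. d - j"]) auto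
  finally show ?thesis by (simp add: harm_def sum_divide_distrib)
qed

lemma sum_a_squared_le: "(\<Sum>j<d. (a j)\<^sup>2) \<le> 1 / 32"
proof -
  have "(\<Sum>j<d. (a j)\<^sup>2) = (\<Sum>j<d. 1 / (real (d - j))\<^sup>2 / 64)"
    unfolding a_def power_divide power_mult_distrib by (simp add: mult.commute)
  also have "\<dots> = (\<Sum>j = 1..d. 1 / (real j)\<^sup>2 / 64)"
    by (rule sum.reindex_bij_witness[of _ "\<lambda>j. d - j" "\<lambda>j. d - j"]) auto
  also have "\<dots> = (\<Sum>j = 1..d. 1 / (real j)\<^sup>2) / 64"
    by (simp add: sum_divide_distrib)
  also have "\<dots> \<le> 2 / 64"
    by (intro divide_right_mono sum_inverse_squares_le) simp
  finally show ?thesis by simp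
qed

lemma norm_h_le:
  assumes "i \<le> d"
  shows "norm (h i) \<le> 1"
proof -
  have "(norm (h i))\<^sup>2 = (\<Sum>k\<in>UNIV. (h i $ k)\<^sup>2)"
    by (simp add: norm_vec_def L2_set_def sum_nonneg)
  also have "\<dots> \<le> (\<Sum>k\<in>UNIV. (a (idx k))\<^sup>2 + (if idx k = i then 1 / 4 else 0))"
  proof (rule sum_mono)
    fix k
    \<comment> \<open>A coordinate with \<open>idx k = i\<close> forces \<open>i < d\<close>, where
      \<open>b i\<close> is at most 1/2.\<close>
    have "(b i)\<^sup>2 \<le> (1 / 2)\<^sup>2" if "idx k = i"
      using that idx_less[of k] b_le_half b_nonneg by (intro power_mono) auto
    then show "(h i $ k)\<^sup>2 \<le> (a (idx k))\<^sup>2 + (if idx k = i then 1 / 4 else 0)"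
      by (auto simp: h_def power2_eq_square add_increasing)
  qed
  also have "\<dots> = (\<Sum>j<d. (a j)\<^sup>2 + (if j = i then 1 / 4 else 0))"
    by (rule sum_idx)
  also have "\<dots> \<le> 1 / 32 + 1 / 4"
    using sum_a_squared_le by (simp add: sum.distrib)
  finally have "(norm (h i))\<^sup>2 \<le> 1\<^sup>2" by simp
  then show ?thesis by (rule power2_le_imp_le) simp
qed

section \<open>Size and support of the iterates\<close>

lemma y_0: "y 0 = 0"
  by (simp add: y_def vec_eq_iff)

text \<open>The step sizes used after coordinate \<open>j\<close> was raised sum to at most
  \<open>2 * (d - j) / sqrt T\<close>, and the factor \<open>d - j\<close> cancels against
  \<open>a j\<close>.\<close>

lemma y_bounds:
  assumes "i \<le> d" "idx k < i"
  shows "1 / (4 * sqrt (real T)) \<le> y i $ k" "y i $ k \<le> 1 / (2 * sqrt (real T))"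
proof -
  let ?S = "\<Sum>m = s + idx k + 2..s + i. 1 / sqrt (real m)"
  have pos: "real (d - idx k) > 0" using idx_less[of k] by simp
  have "?S \<le> 2 * (sqrt (real (s + i)) - sqrt (real (s + idx k + 1)))"
    using sum_inverse_sqrt_le[of "s + idx k + 1" "s + i"] assms by simp
  also have "\<dots> \<le> 2 * (sqrt (real T) - sqrt (real (s + idx k + 1)))"
    using assms s_plus_d by simp
  also have "\<dots> \<le> 2 * ((real T - real (s + idx k + 1)) / sqrt (real T))"
    using s_plus_d idx_less[of k] T_pos by (intro mult_left_mono sqrt_diff_le) auto
  also have "\<dots> \<le> 2 * (real (d - idx k) / sqrt (real T))"
    using s_plus_d idx_less[of k]
    by (intro mult_left_mono divide_right_mono) (auto simp: of_nat_diff)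
  finally have "a (idx k) * ?S \<le> a (idx k) * (2 * (real (d - idx k) / sqrt (real T)))"
    using a_nonneg by (rule mult_left_mono)
  also have "\<dots> = 1 / (4 * sqrt (real T))"
    using pos by (simp add: a_def del: of_nat_diff)
  finally show "1 / (4 * sqrt (real T)) \<le> y i $ k"
    using assms by (simp add: y_def)
  show "y i $ k \<le> 1 / (2 * sqrt (real T))"
    using assms a_nonneg by (simp add: y_def sum_nonneg)
qed

lemma y_unvisited: "i \<le> idx k \<Longrightarrow> y i $ k = 0"
  by (simp add: y_def)

lemma y_nonneg:
  assumes "i \<le> d"
  shows "0 \<le> y i $ k"
proof (cases "idx k < i")
  case True
  have "0 \<le> 1 / (4 * sqrt (real T))" by simp
  then show ?thesis using y_bounds(1)[OF assms True] by (rule order_trans)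
qed (simp add: y_unvisited)

lemma y_in_ball:
  assumes "i \<le> d"
  shows "y i \<in> cball 0 1"
proof -
  have "(norm (y i))\<^sup>2 = (\<Sum>k\<in>UNIV. (y i $ k)\<^sup>2)"
    by (simp add: norm_vec_def L2_set_def sum_nonneg)
  also have "\<dots> \<le> (\<Sum>k::'n\<in>UNIV. (1 / (2 * sqrt (real T)))\<^sup>2)"
  proof (rule sum_mono)
    fix k
    have "y i $ k \<le> 1 / (2 * sqrt (real T))"
      by (cases "idx k < i") (simp_all add: y_bounds(2)[OF assms] y_unvisited)
    then show "(y i $ k)\<^sup>2 \<le> (1 / (2 * sqrt (real T)))\<^sup>2"
      using y_nonneg[OF assms] by (rule power_mono)
  qed
  \<comment> \<open>The sum equals \<open>d / (4 * T)\<close>.\<close>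
  also have "\<dots> \<le> 1\<^sup>2"
    using d_le T_pos by (simp add: card_eq power_divide power_mult_distrib field_simps)
  finally have "norm (y i) \<le> 1" by (rule power2_le_imp_le) simp
  then show ?thesis by simp
qed

text \<open>Only visited coordinates count, and there \<open>h i\<close> has the largest entry of
  all forms.\<close>

lemma h_inner_y_le:
  assumes "i \<le> d"
  shows "h l \<bullet> y i \<le> h i \<bullet> y i"
  unfolding inner_vec_def inner_real_def
proof (rule sum_mono)
  fix k
  show "h l $ k * y i $ k \<le> h i $ k * y i $ k"
  proof (cases "idx k < i")
    case True
    then have "h l $ k \<le> h i $ k"
      using a_nonneg[of "idx k"] b_nonneg[of l] by (auto simp: h_def)
    then show ?thesis
      using y_nonneg[OF assms] by (rule mult_right_mono)
  qed (simp add: y_unvisited)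
qed

lemma h_active_at_y:
  assumes "i \<le> d"
  shows "h i \<in> subdifferential X f (y i)"
proof (rule active_form_in_subdifferential[OF finite_H])
  have "0 \<le> h i $ k * y i $ k" for k
    using y_nonneg[OF assms, of k] a_nonneg
    by (cases "idx k < i") (auto simp: h_def y_unvisited)
  then have "0 \<le> h i \<bullet> y i"
    by (auto simp: inner_vec_def intro: sum_nonneg)
  then show "g \<bullet> y i \<le> h i \<bullet> y i" if "g \<in> H" for g
    using that h_inner_y_le[OF assms] by (auto simp: H_def)
qed (use assms in \<open>simp add: H_def\<close>)

lemma zero_active_at_0: "0 \<in> subdifferential X f 0"
  by (rule active_form_in_subdifferential[OF finite_H]) (auto simp: H_def)

lemma y_Suc: "y (Suc i) = y i - (1 / sqrt (real (s + i + 1))) *\<^sub>R h i"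
proof (unfold vec_eq_iff, rule allI)
  fix k
  let ?r = "sqrt (real (s + i + 1))"
  consider "idx k < i" | "idx k = i" | "i < idx k" by linarith
  then show "y (Suc i) $ k = (y i - (1 / ?r) *\<^sub>R h i) $ k"
  proof cases
    case 1
    then have "(\<Sum>m = s + idx k + 2..s + Suc i. 1 / sqrt (real m))
        = (\<Sum>m = s + idx k + 2..s + i. 1 / sqrt (real m)) + 1 / ?r"
      by simp
    with 1 show ?thesis by (simp add: y_def h_def algebra_simps)
  next
    case 2
    \<comment> \<open>The sum in \<open>y (Suc i)\<close> is empty for the coordinate just
      raised.\<close>
    then show ?thesis by (simp add: y_def h_def b_def)
  qed (simp add: y_def h_def)
qed

section \<open>The descent and its last value\<close>

lemma subgradient_oracle_G: "subgradient_oracle (cball 0 1) f G"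
  using subdifferential_max_form_nonempty[OF finite_H H_nonempty]
  by (auto simp: subgradient_oracle_def G_def some_in_eq)

lemma iter_start: "t \<le> s \<Longrightarrow> iter (Suc t) = 0"
  by (induction t) (auto simp: G_def answer_def zero_active_at_0 closest_point_self)

text \<open>The projection never moves a point, as each \<open>y i\<close> is in the ball.\<close>

lemma iter_eq_y: "i \<le> d \<Longrightarrow> iter (Suc (s + i)) = y i"
proof (induction i)
  case 0
  then show ?case by (simp only: add_0_right iter_start y_0 order_refl)
next
  case (Suc i)
  have "G (Suc (s + i)) (y i) = h i"
    using Suc.prems by (simp add: G_def answer_def h_active_at_y)
  then have "iter (Suc (s + Suc i)) = closest_point (cball 0 1) (y (Suc i))"
    using Suc by (simp add: y_Suc)
  then show ?case
    using y_in_ball[OF Suc.prems] by (simp only: closest_point_self)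
qed

lemma f_nonneg: "0 \<le> f x"
  using max_form_ge[OF finite_H, of 0 x] by (simp add: H_def)

lemma f_0: "f 0 = 0"
  by (simp add: max_form_def H_def)

lemma last_value_ge: "f (iter (T + 1)) \<ge> ln (real d) / (32 * sqrt (real T))"
proof -
  have "ln (real d) \<le> harm d"
    using ln_le_harm[of d] by (rule order_trans[rotated]) (use d_pos in simp)
  then have "ln (real d) / (32 * sqrt (real T)) \<le> harm d / (32 * sqrt (real T))"
    by (rule divide_right_mono) simp
  \<comment> \<open>The 32 splits into 8 from the weights and 4 from the coordinate bound.\<close>
  also have "\<dots> = (\<Sum>k\<in>UNIV. a (idx k) * (1 / (4 * sqrt (real T))))"
    by (simp add: sum_idx sum_a_eq flip: sum_distrib_right sum_divide_distrib)
  also have "\<dots> \<le> (\<Sum>k\<in>UNIV. h d $ k * y d $ k)"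
    using y_bounds(1)[OF order_refl] idx_less a_nonneg
    by (intro sum_mono) (simp add: h_def mult_left_mono del: mult_1_right times_divide_eq_right)
  also have "\<dots> = h d \<bullet> y d"
    by (simp add: inner_vec_def)
  also have "\<dots> \<le> f (y d)"
    by (rule max_form_ge[OF finite_H]) (simp add: H_def)
  also have "y d = iter (T + 1)"
    using iter_eq_y[of d] s_plus_d by simp
  finally show ?thesis .
qed

end

theorem theorem3p6:
  fixes T :: nat and X :: "(real ^ 'n::finite) set"
  assumes "CARD('n) \<le> T"
    and "X = cball 0 1"
  shows "\<exists>(f :: real ^ 'n \<Rightarrow> real) G xmin.
           convex_on X f \<and> 1-lipschitz_on X f \<and> subgradient_oracle X f G \<and>
           is_arg_min f (\<lambda>x. x \<in> X) xmin \<and>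
           f (psgd X G (\<lambda>t. 1 / sqrt (real t)) 0 (T + 1)) - f xmin
             \<ge> ln (real CARD('n)) / (32 * sqrt (real T))"
proof -
  obtain idx :: "'n \<Rightarrow> nat" where "bij_betw idx UNIV {..<CARD('n)}"
    using ex_bij_betw_finite_nat[OF finite_class.finite_UNIV] by (auto simp: atLeast0LessThan)
  then interpret hard_instance idx "CARD('n)" T
    using assms(1) by unfold_locales
  show ?thesis
    unfolding assms(2)
  proof (intro exI conjI)
    show "convex_on (cball 0 1) f"
      by (rule convex_on_max_form[OF finite_H H_nonempty]) simp
    show "1-lipschitz_on (cball 0 1) f"
      by (rule lipschitz_on_max_form[OF finite_H H_nonempty]) (auto simp: H_def norm_h_le)
    show "subgradient_oracle (cball 0 1) f G"
      by (rule subgradient_oracle_G)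
    show "is_arg_min f (\<lambda>x. x \<in> cball 0 1) 0"
      using f_nonneg by (auto simp: is_arg_min_def f_0 not_less)
    show "f (iter (T + 1)) - f 0 \<ge> ln (real CARD('n)) / (32 * sqrt (real T))"
      using last_value_ge by (simp add: f_0)
  qed
qed

end
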